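(* Let $P(\lambda)=\sum_{j=0}^m\lambda^jA_j\in\mathbb{C}[\lambda]^{n\times n}$ be regular, $B\in\mathbb{C}^{n\times r}$, $C\in\mathbb{C}^{r\times n}$, $D\in\mathbb{C}^{r\times r}$, let $\mathcal{S}(\lambda)=\begin{bmatrix}-P(\lambda)&B\\ C&D\end{bmatrix}$, and let $G(\lambda)=CP(\lambda)^{-1}B+D$, where $G(\lambda)$ is assumed regular. Let $\sigma:\{0,\ldots,m-1\}\to\{1,\ldots,m\}$ be a bijection, let $\mathbb{S}_\sigma(\lambda)$ be the Fiedler linearization of $\mathcal{S}(\lambda)$ associated with $\sigma$, and let $E_\sigma(P)$ and $H_\sigma(P)$ be the $nm\times n$ matrix polynomials defined in the context. Let $\lambda\in\mathbb{C}$ be an eigenvalue of $G(\lambda)$ with $P(\lambda)$ invertible, and evaluate $E_\sigma(P)$ and $H_\sigma(P)$ at this $\lambda$. (a) The map $\mathbb{E}_\sigma(G):\mathbb{C}^r\to\mathbb{C}^{nm+r}$ defined by $$\mathbb{E}_\sigma(G)x=\begin{bmatrix}E_\sigma(P)P(\lambda)^{-1}Bx\\ x\end{bmatrix}$$ is an isomorphism from $\mathcal{N}_r(G(\lambda))$ to $\mathcal{N}_r(\mathbb{S}_\sigma(\lambda))$. (b) The map $\mathbb{H}_\sigma(G):\mathbb{C}^r\to\mathbb{C}^{nm+r}$ defined by $$\mathbb{H}_\sigma(G)y=\begin{bmatrix}H_\sigma(P)(CP(\lambda)^{-1})^Ty\\ y\end{bmatrix}$$ is an isomorphism from $\mathcal{N}_l(G(\lambda))$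 to $\mathcal{N}_l(\mathbb{S}_\sigma(\lambda))$.
   Context: A square polynomial or rational matrix is regular if its determinant is not identically zero; a matrix polynomial is unimodular if its determinant is a nonzero constant. $\lambda\in\mathbb{C}$ is an eigenvalue of the regular $r\times r$ rational matrix $G$ if $\mathrm{rank}\,G(\lambda)<r$. For a constant matrix $A$ (here the value of $G$ or $\mathbb{S}_\sigma$ at the fixed $\lambda$), $\mathcal{N}_r(A)=\{x:Ax=0\}$ and $\mathcal{N}_l(A)=\{y:y^TA=0\}$. $e_j$ is the $j$-th column of $I_m$; $\otimes$ is the Kronecker product. Fiedler matrices of $P$ ($nm\times nm$): $M_0=\mathrm{diag}(I_{(m-1)n},-A_0)$; $M_m=\mathrm{diag}(A_m,I_{(m-1)n})$; for $i=1,\ldots,m-1$, $M_i=\mathrm{diag}\left(I_{(m-i-1)n},\begin{bmatrix}-A_i&I_n\\ I_n&0\end{bmatrix},I_{(i-1)n}\right)$; $M_\sigma:=M_{\sigma^{-1}(1)}\cdots M_{\sigma^{-1}(m)}$. The Fiedler pencil of $P$ is $L_\sigma(\lambda)=\lambda M_m-M_\sigma$. $\sigma$ has a consecution at $d\in\{0,\ldots,m-2\}$ if $\sigma(d)<\sigma(d+1)$ and an inversion at $d$ if $\sigma(d)>\sigma(d+1)$. $\mathrm{CISS}(\sigma)=(c_1,i_1,\ldots,c_l,i_l)$ means that $\sigma$ has $c_1$ consecutive consecutions at $0,\ldots,c_1-1$, then $i_1$ consecutive inversions at $c_1,\ldots,c_1+i_1-1$, and so on, up to $i_l$ inversions at $m-1-i_l,\ldots,m-2$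 (only $c_1$ and $i_l$ may be zero; for $m=1$ the sequence is $(0,0)$). The Fiedler linearization of $\mathcal{S}(\lambda)$ associated with $\sigma$ is $\mathbb{S}_\sigma(\lambda)=\begin{bmatrix}-L_\sigma(\lambda)&e_m\otimes B\\ e_{m-c_1}^T\otimes C&D\end{bmatrix}$ if $c_1>0$, and $\mathbb{S}_\sigma(\lambda)=\begin{bmatrix}-L_\sigma(\lambda)&e_{m-i_1}\otimes B\\ e_m^T\otimes C&D\end{bmatrix}$ if $c_1=0$. The maps $E_\sigma(P),H_\sigma(P)$. It is known that there are unimodular $U(\lambda),V(\lambda)\in\mathbb{C}[\lambda]^{nm\times nm}$ with $U(\lambda)L_\sigma(\lambda)V(\lambda)=\mathrm{diag}(I_{(m-1)n},P(\lambda))$, $(e_m^T\otimes I_n)V(\lambda)^{-1}=e_{m-c_1}^T\otimes I_n$, and $U(\lambda)^{-1}(e_m\otimes I_n)$ equal to $e_m\otimes I_n$ if $c_1>0$ and to $e_{m-i_1}\otimes I_n$ if $c_1=0$. Fix such $U,V$ and set $E_\sigma(P)=V(\lambda)(e_m\otimes I_n)$ and $H_\sigma(P)=U(\lambda)^T(e_m\otimes I_n)$. *)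

theory Defs
  imports
    "Jordan_Normal_Form.DL_Rank"
    "Jordan_Normal_Form.Matrix_Kernel"
    "HOL-Computational_Algebra.Polynomial_Factorial"
    "HOL-Computational_Algebra.Field_as_Ring"
begin

section \<open>Matrices over a commutative ring\<close>

text \<open>
  The entries may be constants, polynomials or rational functions. In particular the inverse of a
  unimodular matrix polynomial is again a matrix polynomial. For matrices that are not invertible
  the value of \<open>mat_inv\<close> is unspecified.
\<close>

definition mat_inv :: "'a :: comm_ring_1 mat \<Rightarrow> 'a mat" where
  "mat_inv A = (THE B. B \<in> carrier_mat (dim_col A) (dim_row A) \<and> inverts_mat A B \<and> inverts_mat B A)"

lemma mat_inv_eqI:
  assumes A: "A \<in> carrier_mat k k" and B: "B \<in> carrier_mat k k"
    and AB: "A * B = 1\<^sub>m k" and BA: "B * A = 1\<^sub>m k"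
  shows "mat_inv A = B"
  unfolding mat_inv_def
proof (rule the_equality)
  show "B \<in> carrier_mat (dim_col A) (dim_row A) \<and> inverts_mat A B \<and> inverts_mat B A"
    using assms by (auto simp: inverts_mat_def)
next
  fix X assume "X \<in> carrier_mat (dim_col A) (dim_row A) \<and> inverts_mat A X \<and> inverts_mat X A"
  then have X: "X \<in> carrier_mat k k" and AX: "A * X = 1\<^sub>m k"
    using A by (auto simp: inverts_mat_def)
  have "X = (B * A) * X" using X by (simp add: BA)
  also have "\<dots> = B * (A * X)" using A B X by (simp add: assoc_mult_mat)
  also have "\<dots> = B" using B by (simp add: AX)
  finally show "X = B" .
qed

definition kronecker :: "'a :: comm_ring_1 mat \<Rightarrow> 'a mat \<Rightarrow> 'a mat" (infixl \<open>\<otimes>\<^sub>K\<close> 75) where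
  "A \<otimes>\<^sub>K B = mat (dim_row A * dim_row B) (dim_col A * dim_col B)
     (\<lambda>(i, j). A $$ (i div dim_row B, j div dim_col B) * B $$ (i mod dim_row B, j mod dim_col B))"

text \<open>The \<open>j\<close>-th column of the identity, as an \<open>m \<times> 1\<close> matrix; \<open>j\<close> counts from \<open>1\<close>.\<close>

definition e_col :: "nat \<Rightarrow> nat \<Rightarrow> 'a :: comm_ring_1 mat" where
  "e_col m j = mat_of_cols m [col (1\<^sub>m m) (j - 1)]"

definition left_kernel :: "'a :: comm_ring_1 mat \<Rightarrow> 'a vec set" where
  "left_kernel A = {y \<in> carrier_vec (dim_row A). mat_of_row y * A = 0\<^sub>m 1 (dim_col A)}"

text \<open>\<open>T\<close> restricts to an isomorphism from the subspace \<open>S\<close> of \<open>K\<^sup>k\<close> onto the subspace \<open>S'\<close> of \<open>K\<^sup>l\<close>.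
  That \<open>S\<close> and \<open>S'\<close> are vector spaces is part of \<^const>\<open>linear_map\<close>.\<close>

definition vec_space_iso ::
  "nat \<Rightarrow> 'a :: field vec set \<Rightarrow> nat \<Rightarrow> 'a vec set \<Rightarrow> ('a vec \<Rightarrow> 'a vec) \<Rightarrow> bool" where
  "vec_space_iso k S l S' T \<longleftrightarrow>
     linear_map class_ring (module_vec TYPE('a) k\<lparr>carrier := S\<rparr>)
       (module_vec TYPE('a) l\<lparr>carrier := S'\<rparr>) T \<and>
     bij_betw T S S'"


section \<open>Matrix polynomials and rational matrices\<close>

text \<open>The determinant lives in \<open>\<complex>[\<lambda>]\<close> or \<open>\<complex>(\<lambda>)\<close>, where being nonzero means not being
  identically zero.\<close>

definition regular_mat :: "'a :: comm_ring_1 mat \<Rightarrow> bool" where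
  "regular_mat A \<longleftrightarrow> square_mat A \<and> det A \<noteq> 0"

definition unimodular :: "complex poly mat \<Rightarrow> bool" where
  "unimodular A \<longleftrightarrow> square_mat A \<and> (\<exists>c. c \<noteq> 0 \<and> det A = [:c:])"

definition matrix_polynomial :: "nat \<Rightarrow> nat \<Rightarrow> (nat \<Rightarrow> complex mat) \<Rightarrow> complex poly mat" where
  "matrix_polynomial n m A = mat n n (\<lambda>(i, k). \<Sum>j\<le>m. monom (A j $$ (i, k)) j)"

abbreviation const_poly_mat :: "complex mat \<Rightarrow> complex poly mat" where
  "const_poly_mat \<equiv> map_mat (\<lambda>a. [:a:])"

definition eval_poly_mat :: "complex poly mat \<Rightarrow> complex \<Rightarrow> complex mat" where
  "eval_poly_mat A z = map_mat (\<lambda>p. poly p z) A"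

text \<open>Since \<^const>\<open>quot_of_fract\<close> yields coprime numerator and denominator, the poles of a rational
  function are the roots of the denominator. The value assigned to \<open>eval_fract\<close> at a pole
  is meaningless.\<close>

definition is_pole_fract :: "complex poly fract \<Rightarrow> complex \<Rightarrow> bool" where
  "is_pole_fract q z \<longleftrightarrow> poly (snd (quot_of_fract q)) z = 0"

definition eval_fract :: "complex poly fract \<Rightarrow> complex \<Rightarrow> complex" where
  "eval_fract q z = poly (fst (quot_of_fract q)) z / poly (snd (quot_of_fract q)) z"

definition eval_rational_mat :: "complex poly fract mat \<Rightarrow> complex \<Rightarrow> complex mat" where
  "eval_rational_mat G z = map_mat (\<lambda>q. eval_fract q z) G"

text \<open>An eigenvalue of a regular \<open>r \<times> r\<close> rational matrix \<open>G\<close>: \<open>rank G(z) < r\<close>, where \<open>G(z)\<close> has to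
  be defined, i.e. no entry of \<open>G\<close> has a pole at \<open>z\<close>.\<close>

definition rational_eigenvalue :: "complex poly fract mat \<Rightarrow> complex \<Rightarrow> bool" where
  "rational_eigenvalue G z \<longleftrightarrow>
     (\<forall>q \<in> elements_mat G. \<not> is_pole_fract q z) \<and>
     vec_space.rank (dim_row G) (eval_rational_mat G z) < dim_row G"

text \<open>\<open>G = C P\<^sup>-\<^sup>1 B + D\<close>, computed over the field \<open>\<complex>(\<lambda>)\<close>\<close>

definition transfer_function ::
  "complex poly mat \<Rightarrow> complex mat \<Rightarrow> complex mat \<Rightarrow> complex mat \<Rightarrow> complex poly fract mat" where
  "transfer_function P B C D =
     map_mat to_fract (const_poly_mat C) * mat_inv (map_mat to_fract P)
       * map_mat to_fract (const_poly_mat B)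
     + map_mat to_fract (const_poly_mat D)"


section \<open>Consecutions and inversions\<close>

definition consecution_at :: "(nat \<Rightarrow> nat) \<Rightarrow> nat \<Rightarrow> bool" where
  "consecution_at \<sigma> d \<longleftrightarrow> \<sigma> d < \<sigma> (d + 1)"

definition inversion_at :: "(nat \<Rightarrow> nat) \<Rightarrow> nat \<Rightarrow> bool" where
  "inversion_at \<sigma> d \<longleftrightarrow> \<sigma> d > \<sigma> (d + 1)"

text \<open>The list \<open>[(c\<^sub>1, i\<^sub>1), \<dots>, (c\<^sub>l, i\<^sub>l)]\<close> describes the runs of consecutions and inversions that
  start at position \<open>d\<close>.\<close>

fun runs_from :: "(nat \<Rightarrow> nat) \<Rightarrow> nat \<Rightarrow> (nat \<times> nat) list \<Rightarrow> bool" where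
  "runs_from \<sigma> d [] \<longleftrightarrow> True"
| "runs_from \<sigma> d ((c, i) # ps) \<longleftrightarrow>
     (\<forall>k \<in> {d..<d + c}. consecution_at \<sigma> k) \<and>
     (\<forall>k \<in> {d + c..<d + c + i}. inversion_at \<sigma> k) \<and>
     runs_from \<sigma> (d + c + i) ps"

text \<open>The runs exhaust the positions \<open>0, \<dots>, m - 2\<close>, and only \<open>c\<^sub>1\<close> and \<open>i\<^sub>l\<close> may vanish.\<close>

definition is_CISS :: "nat \<Rightarrow> (nat \<Rightarrow> nat) \<Rightarrow> (nat \<times> nat) list \<Rightarrow> bool" where
  "is_CISS m \<sigma> ps \<longleftrightarrow>
     ps \<noteq> [] \<and> runs_from \<sigma> 0 ps \<and> (\<Sum>(c, i)\<leftarrow>ps. c + i) = m - 1 \<and>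
     (\<forall>(c, i) \<in> set (tl ps). c > 0) \<and> (\<forall>(c, i) \<in> set (butlast ps). i > 0)"

definition CISS :: "nat \<Rightarrow> (nat \<Rightarrow> nat) \<Rightarrow> (nat \<times> nat) list" where
  "CISS m \<sigma> = (THE ps. is_CISS m \<sigma> ps)"

definition ciss_c1 :: "nat \<Rightarrow> (nat \<Rightarrow> nat) \<Rightarrow> nat" where
  "ciss_c1 m \<sigma> = fst (hd (CISS m \<sigma>))"

definition ciss_i1 :: "nat \<Rightarrow> (nat \<Rightarrow> nat) \<Rightarrow> nat" where
  "ciss_i1 m \<sigma> = snd (hd (CISS m \<sigma>))"

lemma ex1_runs:
  assumes "\<And>k. d \<le> k \<Longrightarrow> k < d + N \<Longrightarrow> \<sigma> k \<noteq> \<sigma> (k + 1)"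
  shows "\<exists>!ps. ps \<noteq> [] \<and> runs_from \<sigma> d ps \<and> (\<Sum>(c, i)\<leftarrow>ps. c + i) = N \<and>
     (\<forall>(c, i) \<in> set (tl ps). c > 0) \<and> (\<forall>(c, i) \<in> set (butlast ps). i > 0)"
    (is "\<exists>!ps. ?Q d N ps")
  using assms
proof (induction N arbitrary: d)
  case 0
  show ?case
  proof (rule ex1I)
    show "?Q d 0 [(0, 0)]" by simp
  next
    fix ps assume Q: "?Q d 0 ps"
    then obtain c i cs where ps: "ps = (c, i) # cs" by (cases ps) auto
    with Q have "c = 0" "i = 0" "cs = []" by (auto split: if_splits)
    then show "ps = [(0, 0)]" by (simp add: ps)
  qed
next
  case (Suc N)
  have IH: "\<exists>!ps. ?Q (Suc d) N ps" by (rule Suc.IH) (use Suc.prems in auto)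
  then obtain c i cs where Q: "?Q (Suc d) N ((c, i) # cs)"
    by (metis list.exhaust surj_pair)
  have uniq: "ps = (c, i) # cs" if "?Q (Suc d) N ps" for ps
    using IH Q that by blast
  have split_first: "{d..<Suc (d + k)} = insert d {Suc d..<Suc (d + k)}" for k
    by auto
  consider (con) "consecution_at \<sigma> d" "\<not> inversion_at \<sigma> d"
    | (inv) "inversion_at \<sigma> d" "\<not> consecution_at \<sigma> d"
    using Suc.prems[of d] by (fastforce simp: consecution_at_def inversion_at_def nat_neq_iff)
  then show ?case
  proof cases
    case con
    show ?thesis
    proof (rule ex1I)
      show "?Q d (Suc N) ((Suc c, i) # cs)"
        using Q con by (auto simp: split_first split: if_splits)
    next
      fix ps assume Q': "?Q d (Suc N) ps"
      then obtain c' i' cs' where ps: "ps = (c', i') # cs'" by (cases ps) auto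
      have "c' \<noteq> 0"
      proof
        assume c': "c' = 0"
        have "i' \<noteq> 0" using Q' ps c' by (auto split: if_splits)
        then have "inversion_at \<sigma> d" using Q' ps c' by auto
        with con show False by simp
      qed
      then obtain c'' where c'': "c' = Suc c''" by (cases c') auto
      have "?Q (Suc d) N ((c'', i') # cs')"
        using Q' unfolding ps c'' by (auto simp: split_first split: if_splits)
      from uniq[OF this] show "ps = (Suc c, i) # cs" by (simp add: ps c'')
    qed
  next
    case inv
    have c0: "c' = 0 \<and> i' \<noteq> 0" if "?Q d (Suc N) ((c', i') # cs')" for c' i' cs'
    proof -
      have c0: "c' = 0"
      proof (rule ccontr)
        assume "c' \<noteq> 0"
        then have "consecution_at \<sigma> d" using that by auto
        with inv show False by simp
      qed
      moreover have "i' \<noteq> 0" using that c0 by (auto split: if_splits)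
      ultimately show ?thesis by simp
    qed
    have strip: "(if i' = 1 \<and> cs' \<noteq> [] then cs' else (0, i' - 1) # cs') = (c, i) # cs"
      if Q': "?Q d (Suc N) ((0, i') # cs')" for i' cs'
    proof -
      obtain i'' where i'': "i' = Suc i''" using c0[OF Q'] by (cases i') auto
      show ?thesis
      proof (cases "i'' = 0 \<and> cs' \<noteq> []")
        case True
        have "?Q (Suc d) N cs'"
          using Q' True unfolding i'' by (cases cs') (auto split: if_splits)
        from uniq[OF this] show ?thesis using True by (simp add: i'')
      next
        case False
        have "?Q (Suc d) N ((0, i'') # cs')"
          using Q' False unfolding i'' by (auto simp: split_first split: if_splits)
        from uniq[OF this] show ?thesis using False by (simp add: i'')
      qed
    qed
    show ?thesis
    proof (cases "c = 0")
      case True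
      show ?thesis
      proof (rule ex1I)
        show "?Q d (Suc N) ((0, Suc i) # cs)"
          using Q inv True by (auto simp: split_first split: if_splits)
      next
        fix ps assume Q': "?Q d (Suc N) ps"
        then obtain c' i' cs' where ps: "ps = (c', i') # cs'" by (cases ps) auto
        have 0: "c' = 0" "i' \<noteq> 0" using c0 Q' unfolding ps by blast+
        have s: "(if i' = 1 \<and> cs' \<noteq> [] then cs' else (0, i' - 1) # cs') = (c, i) # cs"
          using strip Q' unfolding ps 0 by blast
        have "\<not> (i' = 1 \<and> cs' \<noteq> [])"
        proof
          assume a: "i' = 1 \<and> cs' \<noteq> []"
          with s True have "cs' = (0, i) # cs" by simp
          with Q' show False unfolding ps by auto
        qed
        with s 0 show "ps = (0, Suc i) # cs" unfolding ps by (auto split: if_splits)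
      qed
    next
      case False
      show ?thesis
      proof (rule ex1I)
        show "?Q d (Suc N) ((0, 1) # (c, i) # cs)"
          using Q inv False by auto
      next
        fix ps assume Q': "?Q d (Suc N) ps"
        then obtain c' i' cs' where ps: "ps = (c', i') # cs'" by (cases ps) auto
        have 0: "c' = 0" "i' \<noteq> 0" using c0 Q' unfolding ps by blast+
        have s: "(if i' = 1 \<and> cs' \<noteq> [] then cs' else (0, i' - 1) # cs') = (c, i) # cs"
          using strip Q' unfolding ps 0 by blast
        with 0 False show "ps = (0, 1) # (c, i) # cs"
          unfolding ps by (auto split: if_splits)
      qed
    qed
  qed
qed

lemma CISS_ex1:
  assumes "m \<ge> 1" "bij_betw \<sigma> {0..m - 1} {1..m}"
  shows "\<exists>!ps. is_CISS m \<sigma> ps"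
  unfolding is_CISS_def
proof (rule ex1_runs)
  fix k assume "k < 0 + (m - 1)"
  with assms(1) have "k \<in> {0..m - 1}" "k + 1 \<in> {0..m - 1}" by auto
  with assms(2) show "\<sigma> k \<noteq> \<sigma> (k + 1)"
    by (metis bij_betw_def inj_onD add_cancel_left_right zero_neq_one)
qed

lemma is_CISS_CISS:
  assumes "m \<ge> 1" "bij_betw \<sigma> {0..m - 1} {1..m}"
  shows "is_CISS m \<sigma> (CISS m \<sigma>)"
  unfolding CISS_def by (rule theI') (rule CISS_ex1[OF assms])


section \<open>Fiedler pencils and Fiedler linearizations\<close>

definition fiedler_mat :: "nat \<Rightarrow> nat \<Rightarrow> (nat \<Rightarrow> complex mat) \<Rightarrow> nat \<Rightarrow> complex mat" where
  "fiedler_mat n m A i =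
     (if i = 0 then diag_block_mat [1\<^sub>m ((m - 1) * n), - A 0]
      else if i = m then diag_block_mat [A m, 1\<^sub>m ((m - 1) * n)]
      else diag_block_mat
        [1\<^sub>m ((m - i - 1) * n), four_block_mat (- A i) (1\<^sub>m n) (1\<^sub>m n) (0\<^sub>m n n), 1\<^sub>m ((i - 1) * n)])"

text \<open>\<open>M\<^sub>\<sigma> = M\<^bsub>\<sigma>\<^sup>-\<^sup>1(1)\<^esub> \<cdots> M\<^bsub>\<sigma>\<^sup>-\<^sup>1(m)\<^esub>\<close>, in this order\<close>

definition fiedler_prod :: "nat \<Rightarrow> nat \<Rightarrow> (nat \<Rightarrow> complex mat) \<Rightarrow> (nat \<Rightarrow> nat) \<Rightarrow> complex mat" where
  "fiedler_prod n m A \<sigma> =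
     foldr (*) (map (\<lambda>k. fiedler_mat n m A (inv_into {0..m - 1} \<sigma> k)) [1..<m + 1]) (1\<^sub>m (n * m))"

definition fiedler_pencil ::
  "nat \<Rightarrow> nat \<Rightarrow> (nat \<Rightarrow> complex mat) \<Rightarrow> (nat \<Rightarrow> nat) \<Rightarrow> complex poly mat" where
  "fiedler_pencil n m A \<sigma> =
     [:0, 1:] \<cdot>\<^sub>m const_poly_mat (fiedler_mat n m A m) - const_poly_mat (fiedler_prod n m A \<sigma>)"

text \<open>The Fiedler linearization of \<open>[-P, B; C, D]\<close>, where \<open>P\<close> has the coefficients \<open>A\<close>\<close>

definition fiedler_linearization ::
  "nat \<Rightarrow> nat \<Rightarrow> (nat \<Rightarrow> complex mat) \<Rightarrow> complex mat \<Rightarrow> complex mat \<Rightarrow> complex mat \<Rightarrow>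
   (nat \<Rightarrow> nat) \<Rightarrow> complex poly mat" where
  "fiedler_linearization n m A B C D \<sigma> =
     (if ciss_c1 m \<sigma> > 0 then
        four_block_mat
          (- fiedler_pencil n m A \<sigma>)
          (const_poly_mat (e_col m m \<otimes>\<^sub>K B))
          (const_poly_mat (transpose_mat (e_col m (m - ciss_c1 m \<sigma>)) \<otimes>\<^sub>K C))
          (const_poly_mat D)
      else
        four_block_mat
          (- fiedler_pencil n m A \<sigma>)
          (const_poly_mat (e_col m (m - ciss_i1 m \<sigma>) \<otimes>\<^sub>K B))
          (const_poly_mat (transpose_mat (e_col m m) \<otimes>\<^sub>K C))
          (const_poly_mat D))"

text \<open>The unimodular transformations that reduce \<open>L\<^sub>\<sigma>\<close> to \<open>diag(I, P)\<close> and are normalized on the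
  last block row and block column; \<open>E\<^sub>\<sigma>(P)\<close> and \<open>H\<^sub>\<sigma>(P)\<close> are formed from a fixed choice of them.\<close>

definition fiedler_reduction ::
  "nat \<Rightarrow> nat \<Rightarrow> (nat \<Rightarrow> complex mat) \<Rightarrow> (nat \<Rightarrow> nat) \<Rightarrow>
   complex poly mat \<Rightarrow> complex poly mat \<Rightarrow> bool" where
  "fiedler_reduction n m A \<sigma> U V \<longleftrightarrow>
     U \<in> carrier_mat (n * m) (n * m) \<and> V \<in> carrier_mat (n * m) (n * m) \<and>
     unimodular U \<and> unimodular V \<and>
     U * fiedler_pencil n m A \<sigma> * V
       = diag_block_mat [1\<^sub>m ((m - 1) * n), matrix_polynomial n m A] \<and>
     (transpose_mat (e_col m m) \<otimes>\<^sub>K 1\<^sub>m n) * mat_inv V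
       = transpose_mat (e_col m (m - ciss_c1 m \<sigma>)) \<otimes>\<^sub>K 1\<^sub>m n \<and>
     mat_inv U * (e_col m m \<otimes>\<^sub>K 1\<^sub>m n)
       = (if ciss_c1 m \<sigma> > 0 then e_col m m else e_col m (m - ciss_i1 m \<sigma>)) \<otimes>\<^sub>K 1\<^sub>m n"

definition E_poly :: "nat \<Rightarrow> nat \<Rightarrow> complex poly mat \<Rightarrow> complex poly mat" where
  "E_poly n m V = V * (e_col m m \<otimes>\<^sub>K 1\<^sub>m n)"

definition H_poly :: "nat \<Rightarrow> nat \<Rightarrow> complex poly mat \<Rightarrow> complex poly mat" where
  "H_poly n m U = transpose_mat U * (e_col m m \<otimes>\<^sub>K 1\<^sub>m n)"

definition E_map ::
  "nat \<Rightarrow> nat \<Rightarrow> complex poly mat \<Rightarrow> complex poly mat \<Rightarrow> complex mat \<Rightarrow> complex \<Rightarrow>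
   complex vec \<Rightarrow> complex vec" where
  "E_map n m V P B z x =
     (eval_poly_mat (E_poly n m V) z * mat_inv (eval_poly_mat P z) * B *\<^sub>v x) @\<^sub>v x"

definition H_map ::
  "nat \<Rightarrow> nat \<Rightarrow> complex poly mat \<Rightarrow> complex poly mat \<Rightarrow> complex mat \<Rightarrow> complex \<Rightarrow>
   complex vec \<Rightarrow> complex vec" where
  "H_map n m U P C z y =
     (eval_poly_mat (H_poly n m U) z * transpose_mat (C * mat_inv (eval_poly_mat P z)) *\<^sub>v y) @\<^sub>v y"

end

theory Submission
  imports Defs
begin

text \<open>
  With \<open>E = e\<^sub>m \<otimes> I\<close>, \<open>F = U\<^sup>-\<^sup>1 E\<close> and \<open>K\<^sup>T = E\<^sup>T V\<^sup>-\<^sup>1\<close>, the Fiedler linearization has the blocks \<open>-L\<close>,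
  \<open>F B\<close>, \<open>C K\<^sup>T\<close> and \<open>D\<close>. From \<open>U L V = diag(I, P)\<close> one gets \<open>L (V E) = F P\<close> and \<open>K\<^sup>T (V E) = I\<close>.
  Hence, where \<open>P\<close> is invertible, so is \<open>L\<close>, its Schur complement is \<open>C P\<^sup>-\<^sup>1 B + D = G\<close>, and the kernel
  is parametrized by \<open>x \<mapsto> (V E P\<^sup>-\<^sup>1 B x, x)\<close>. The left kernels are the same statement for the
  transposed data, which exchange \<open>U\<close> with \<open>V\<^sup>T\<close>, \<open>F\<close> with \<open>K\<close> and \<open>B\<close> with \<open>C\<^sup>T\<close>.
\<close>

section \<open>Inverses, kernels and Schur complements\<close>

text \<open>The adjugate scaled by the inverse of the determinant is a two-sided inverse over any
  commutative ring. This one argument serves unimodular polynomial matrices, matrices of rational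
  functions and complex matrices.\<close>

lemma mat_inv_unit_det:
  fixes A :: "'a :: comm_ring_1 mat"
  assumes A: "A \<in> carrier_mat k k" and unit: "det A dvd 1"
  shows "mat_inv A \<in> carrier_mat k k" "A * mat_inv A = 1\<^sub>m k" "mat_inv A * A = 1\<^sub>m k"
proof -
  from unit obtain c where c: "1 = det A * c" by (auto simp: dvd_def)
  let ?B = "c \<cdot>\<^sub>m adj_mat A"
  note adj = adj_mat[OF A]
  have B: "?B \<in> carrier_mat k k" using adj(1) by simp
  have AB: "A * ?B = 1\<^sub>m k"
    using c by (simp add: mult_smult_distrib[OF A adj(1)] adj(2)) (auto simp: mult.commute)
  have BA: "?B * A = 1\<^sub>m k"
    using c by (simp add: mult_smult_assoc_mat[OF adj(1) A] adj(3)) (auto simp: mult.commute)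
  have "mat_inv A = ?B" by (rule mat_inv_eqI[OF A B AB BA])
  then show "mat_inv A \<in> carrier_mat k k" "A * mat_inv A = 1\<^sub>m k" "mat_inv A * A = 1\<^sub>m k"
    using AB BA B by simp_all
qed

text \<open>The locale \<open>kernel\<close> already makes both kernels vector spaces, so the linear
  structure of \<open>vec_space_iso\<close> reduces to additivity and homogeneity of
  \<open>T\<close>, required on the whole ambient space.\<close>

lemma vec_space_iso_mat_kernel:
  fixes A S :: "'a :: field mat"
  assumes A: "A \<in> carrier_mat p k" and S: "S \<in> carrier_mat q l"
    and T: "bij_betw T (mat_kernel A) (mat_kernel S)"
    and add: "\<And>x y. x \<in> carrier_vec k \<Longrightarrow> y \<in> carrier_vec k \<Longrightarrow> T (x + y) = T x + T y"
    and smult: "\<And>c x. x \<in> carrier_vec k \<Longrightarrow> T (c \<cdot>\<^sub>v x) = c \<cdot>\<^sub>v T x"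
  shows "vec_space_iso k (mat_kernel A) l (mat_kernel S) T"
proof -
  interpret KA: kernel p k A by (unfold_locales, rule A)
  interpret KS: kernel q l S by (unfold_locales, rule S)
  have sub: "mat_kernel A \<subseteq> carrier_vec k" using mat_kernel_carrier[OF A] .
  have "T \<in> LinearCombinations.module_hom class_ring KA.VK KS.VK"
    unfolding LinearCombinations.module_hom_def
    using bij_betwE[OF T] sub add smult by (simp add: module_vec_simps subset_iff)
  then have "linear_map class_ring KA.VK KS.VK T"
    by (intro linear_map.intro mod_hom.intro mod_hom_axioms.intro
        KA.Ker.vectorspace_axioms KS.Ker.vectorspace_axioms KA.Ker.module_axioms KS.Ker.module_axioms)
  then show ?thesis using T by (simp add: vec_space_iso_def)
qed

text \<open>The first block row annihilates \<open>v @\<^sub>v x\<close> iff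
  \<open>L v = b x = L (X x)\<close>, which forces \<open>v = X x\<close> because \<open>L\<close>
  is injective. The second block row then says that \<open>x\<close> lies in the kernel of the Schur
  complement. The matrix \<open>X\<close> stands for the inverse of \<open>L\<close> times
  \<open>b\<close>.\<close>

lemma schur_complement_kernel_iso:
  fixes L b c D X :: "'a :: field mat"
  assumes L: "L \<in> carrier_mat k k" and b: "b \<in> carrier_mat k r" and c: "c \<in> carrier_mat r k"
    and D: "D \<in> carrier_mat r r" and X: "X \<in> carrier_mat k r"
    and det: "det L \<noteq> 0" and LX: "L * X = b"
  shows "vec_space_iso r (mat_kernel (c * X + D)) (k + r)
    (mat_kernel (four_block_mat (- L) b c D)) (\<lambda>x. (X *\<^sub>v x) @\<^sub>v x)"
proof (rule vec_space_iso_mat_kernel)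
  let ?S = "four_block_mat (- L) b c D"
  have mL: "- L \<in> carrier_mat k k" using L by simp
  show G: "c * X + D \<in> carrier_mat r r" using c X D by simp
  show S: "?S \<in> carrier_mat (k + r) (k + r)" using mL D by simp
  have S_append: "?S *\<^sub>v (v @\<^sub>v x) = (b *\<^sub>v x - L *\<^sub>v v) @\<^sub>v (c *\<^sub>v v + D *\<^sub>v x)"
    if "v \<in> carrier_vec k" "x \<in> carrier_vec r" for v x
  proof -
    have "- L *\<^sub>v v + b *\<^sub>v x = b *\<^sub>v x - L *\<^sub>v v"
      using that L b by (intro eq_vecI) auto
    then show ?thesis by (simp add: four_block_mat_mult_vec[OF mL b c D that])
  qed
  have zero: "0\<^sub>v (k + r) = 0\<^sub>v k @\<^sub>v 0\<^sub>v r" by (intro eq_vecI) auto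
  have ker: "v @\<^sub>v x \<in> mat_kernel ?S \<longleftrightarrow> v = X *\<^sub>v x \<and> x \<in> mat_kernel (c * X + D)"
    if v: "v \<in> carrier_vec k" and x: "x \<in> carrier_vec r" for v x
  proof -
    have Xx: "X *\<^sub>v x \<in> carrier_vec k" using X x by simp
    have bx: "b *\<^sub>v x = L *\<^sub>v (X *\<^sub>v x)" using L X x by (simp flip: LX)
    have Gx: "(c * X + D) *\<^sub>v x = c *\<^sub>v (X *\<^sub>v x) + D *\<^sub>v x"
      using c X D x by (simp add: add_mult_distrib_mat_vec[of _ r r])
    have "L *\<^sub>v (X *\<^sub>v x) - L *\<^sub>v v = 0\<^sub>v k \<longleftrightarrow> v = X *\<^sub>v x"
    proof
      assume "L *\<^sub>v (X *\<^sub>v x) - L *\<^sub>v v = 0\<^sub>v k"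
      then have "L *\<^sub>v (X *\<^sub>v x - v) = 0\<^sub>v k"
        using L v Xx by (simp add: mult_minus_distrib_mat_vec)
      moreover have "X *\<^sub>v x - v \<in> carrier_vec k" using v Xx by simp
      ultimately have 0: "X *\<^sub>v x - v = 0\<^sub>v k" using det det_0_iff_vec_prod_zero_field[OF L] by blast
      show "v = X *\<^sub>v x"
      proof (rule eq_vecI)
        show "dim_vec v = dim_vec (X *\<^sub>v x)" using v X by simp
      next
        fix i assume i: "i < dim_vec (X *\<^sub>v x)"
        with 0 X have "(X *\<^sub>v x - v) $ i = 0" by simp
        with i v X show "v $ i = (X *\<^sub>v x) $ i" by simp
      qed
    qed (use L Xx in auto)
    moreover have "v @\<^sub>v x \<in> mat_kernel ?S \<longleftrightarrow>
        (L *\<^sub>v (X *\<^sub>v x) - L *\<^sub>v v) @\<^sub>v (c *\<^sub>v v + D *\<^sub>v x) = 0\<^sub>v k @\<^sub>v 0\<^sub>v r"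
      using v x by (simp only: mat_kernel[OF S] mem_Collect_eq S_append bx zero) auto
    moreover have "L *\<^sub>v (X *\<^sub>v x) - L *\<^sub>v v \<in> carrier_vec k" using L v Xx by simp
    ultimately show ?thesis
      using x unfolding mat_kernel[OF G] Gx mem_Collect_eq by (auto simp: append_vec_eq[of _ k])
  qed
  show "bij_betw (\<lambda>x. (X *\<^sub>v x) @\<^sub>v x) (mat_kernel (c * X + D)) (mat_kernel ?S)"
  proof (rule bij_betw_imageI)
    \<comment> \<open>The last block of the image is the argument itself.\<close>
    show "inj_on (\<lambda>x. (X *\<^sub>v x) @\<^sub>v x) (mat_kernel (c * X + D))"
    proof (rule inj_onI)
      fix x y assume *: "x \<in> mat_kernel (c * X + D)" "y \<in> mat_kernel (c * X + D)"
        and eq: "(X *\<^sub>v x) @\<^sub>v x = (X *\<^sub>v y) @\<^sub>v y"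
      have "X *\<^sub>v x \<in> carrier_vec k" "X *\<^sub>v y \<in> carrier_vec k"
        using * X mat_kernel_carrier[OF G] by auto
      from eq[unfolded append_vec_eq[OF this]] show "x = y" by (rule conjunct2)
    qed
    show "(\<lambda>x. (X *\<^sub>v x) @\<^sub>v x) ` mat_kernel (c * X + D) = mat_kernel ?S"
    proof (intro equalityI subsetI)
      fix w assume "w \<in> (\<lambda>x. (X *\<^sub>v x) @\<^sub>v x) ` mat_kernel (c * X + D)"
      then show "w \<in> mat_kernel ?S"
        using ker X mat_kernel_carrier[OF G] by (auto simp: subset_iff)
    next
      fix w assume w: "w \<in> mat_kernel ?S"
      then have "w \<in> carrier_vec (k + r)" using mat_kernel_carrier[OF S] by blast
      then have split: "w = vec_first w k @\<^sub>v vec_last w r" by simp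
      \<comment> \<open>The last \<open>r\<close> entries of a kernel vector are its
        preimage.\<close>
      have "vec_first w k = X *\<^sub>v vec_last w r \<and> vec_last w r \<in> mat_kernel (c * X + D)"
        using ker[of "vec_first w k" "vec_last w r"] w by (simp only: split[symmetric]) simp
      with split show "w \<in> (\<lambda>x. (X *\<^sub>v x) @\<^sub>v x) ` mat_kernel (c * X + D)"
        by (intro image_eqI) auto
    qed
  qed
next
  fix x y :: "'a vec" assume x: "x \<in> carrier_vec r" and y: "y \<in> carrier_vec r"
  then show "(X *\<^sub>v (x + y)) @\<^sub>v (x + y) = ((X *\<^sub>v x) @\<^sub>v x) + ((X *\<^sub>v y) @\<^sub>v y)"
    using X by (simp add: mult_add_distrib_mat_vec[OF X] append_vec_add[of _ k _ _ r])
next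
  fix a and x :: "'a vec" assume "x \<in> carrier_vec r"
  then show "(X *\<^sub>v (a \<cdot>\<^sub>v x)) @\<^sub>v (a \<cdot>\<^sub>v x) = a \<cdot>\<^sub>v ((X *\<^sub>v x) @\<^sub>v x)"
    using X by (intro eq_vecI) (auto simp: mult_mat_vec[OF X])
qed

text \<open>Reduces the claim on left kernels to right kernels of the transposed matrices.\<close>

lemma left_kernel_eq_mat_kernel_transpose:
  "left_kernel A = mat_kernel (transpose_mat A)"
proof -
  have "mat_of_row y * A = 0\<^sub>m 1 (dim_col A) \<longleftrightarrow> transpose_mat A *\<^sub>v y = 0\<^sub>v (dim_col A)"
    if "y \<in> carrier_vec (dim_row A)" for y
  proof -
    have row: "mat_of_row y * A = mat_of_row (transpose_mat A *\<^sub>v y)"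
      using that by (intro eq_matI) (auto simp: comm_scalar_prod[of _ "dim_row A"])
    have zero_row: "mat_of_row w = 0\<^sub>m 1 k \<longleftrightarrow> w = 0\<^sub>v k" if "dim_vec w = k" for w :: "'a vec" and k
      using that by (auto simp: vec_eq_iff mat_eq_iff)
    show ?thesis unfolding row by (rule zero_row) simp
  qed
  then show ?thesis by (auto simp: left_kernel_def mat_kernel_def)
qed

text \<open>Take \<open>X = W P' B\<close> in the Schur complement:
  \<open>L X = F P P' B = F B\<close>, and \<open>E^T X = P' B\<close> turns the complement into
  \<open>C P' B + D\<close>. The roles are kept abstract because the lemma is applied twice. For
  right kernels \<open>W\<close> is \<open>V E\<close> and the matrix \<open>E\<close> of this lemma
  is \<open>K\<close>; for left kernels all data are transposed.\<close>

lemma system_matrix_kernel_iso: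
  fixes L P P' W F E B C D :: "'a :: field mat"
  assumes L: "L \<in> carrier_mat k k" and P: "P \<in> carrier_mat n n" and P': "P' \<in> carrier_mat n n"
    and W: "W \<in> carrier_mat k n" and F: "F \<in> carrier_mat k n" and E: "E \<in> carrier_mat k n"
    and B: "B \<in> carrier_mat n r" and C: "C \<in> carrier_mat r n" and D: "D \<in> carrier_mat r r"
    and det: "det L \<noteq> 0" and PP': "P * P' = 1\<^sub>m n"
    and LW: "L * W = F * P" and EW: "transpose_mat E * W = 1\<^sub>m n"
  shows "vec_space_iso r (mat_kernel (C * P' * B + D)) (k + r)
    (mat_kernel (four_block_mat (- L) (F * B) (C * transpose_mat E) D))
    (\<lambda>x. (W * P' * B *\<^sub>v x) @\<^sub>v x)"
proof -
  have ET: "transpose_mat E \<in> carrier_mat n k" using E by simp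
  have P'B: "P' * B \<in> carrier_mat n r" using P' B by simp
  have WB: "W * P' * B = W * (P' * B)" using W P' B by (rule assoc_mult_mat)
  have "L * (W * P' * B) = L * W * (P' * B)"
    unfolding WB using L W P'B by (rule assoc_mult_mat[symmetric])
  also have "\<dots> = F * (P * (P' * B))" unfolding LW using F P P'B by (rule assoc_mult_mat)
  also have "P * (P' * B) = P * P' * B" using P P' B by (rule assoc_mult_mat[symmetric])
  finally have X: "L * (W * P' * B) = F * B" using B by (simp add: PP')
  have "C * transpose_mat E * (W * P' * B) = C * (transpose_mat E * (W * (P' * B)))"
    unfolding WB using C ET W P'B by (intro assoc_mult_mat) auto
  also have "transpose_mat E * (W * (P' * B)) = transpose_mat E * W * (P' * B)"
    using ET W P'B by (rule assoc_mult_mat[symmetric])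
  also have "C * \<dots> = C * P' * B" using C P' B by (simp add: EW assoc_mult_mat[of _ r n])
  finally have G: "C * transpose_mat E * (W * P' * B) = C * P' * B" .
  have "F * B \<in> carrier_mat k r" "C * transpose_mat E \<in> carrier_mat r k"
    "W * P' * B \<in> carrier_mat k r"
    using F W P' B C E by simp_all
  from schur_complement_kernel_iso[OF L this(1,2) D this(3) det X]
  show ?thesis unfolding G .
qed


section \<open>Block columns of the identity and Kronecker products\<close>

text \<open>Here \<open>E\<close> is the last block column of the identity, so it selects the last
  diagonal block \<open>P\<close> of \<open>N\<close>. The transposed identity is what the left
  kernels need.\<close>

lemma last_identity_block:
  fixes N P E :: "'a :: comm_ring_1 mat"
  assumes P: "P \<in> carrier_mat n n" and m: "m \<ge> 1"
  defines "N \<equiv> diag_block_mat [1\<^sub>m ((m - 1) * n), P]"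
    and "E \<equiv> e_col m m \<otimes>\<^sub>K 1\<^sub>m n"
  shows "N * E = E * P" "transpose_mat N * E = E * transpose_mat P" "transpose_mat E * E = 1\<^sub>m n"
    "E \<in> carrier_mat (n * m) n"
proof -
  let ?a = "(m - 1) * n"
  have mn: "m * n = ?a + n" using m by (cases m) auto
  have E_index: "E $$ (i, j) = (if i = ?a + j then 1 else 0)" if i: "i < ?a + n" and j: "j < n" for i j
  proof -
    have "i div n = m - 1 \<and> i mod n = j \<longleftrightarrow> i = ?a + j"
    proof
      assume "i div n = m - 1 \<and> i mod n = j"
      then show "i = ?a + j" using div_mult_mod_eq[of i n] by simp
    qed (use j in simp)
    moreover have "i div n < m" using i j mn by (simp add: less_mult_imp_div_less)
    ultimately show ?thesis
      using i j m by (auto simp: E_def kronecker_def e_col_def mn mat_of_cols_def)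
  qed
  have E: "E \<in> carrier_mat (?a + n) n"
    by (auto simp: E_def kronecker_def e_col_def mn)
  \<comment> \<open>An empty left block column turns \<open>E\<close> into a two-by-two block
    matrix, so that block multiplication applies.\<close>
  have E_block: "E = four_block_mat (0\<^sub>m ?a 0) (0\<^sub>m ?a n) (0\<^sub>m n 0) (1\<^sub>m n)"
    using E by (intro eq_matI) (auto simp: E_index)
  have N: "N = four_block_mat (1\<^sub>m ?a) (0\<^sub>m ?a n) (0\<^sub>m n ?a) P"
    using P unfolding N_def diag_block_mat.simps(2)[of _ "[P]"] diag_block_mat_singleton Let_def
    by simp
  have NT: "transpose_mat N = four_block_mat (1\<^sub>m ?a) (0\<^sub>m ?a n) (0\<^sub>m n ?a) (transpose_mat P)"
    unfolding N using P by (subst transpose_four_block_mat) auto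
  have block: "four_block_mat (1\<^sub>m ?a) (0\<^sub>m ?a n) (0\<^sub>m n ?a) Q * E = E * Q"
    if Q: "Q \<in> carrier_mat n n" for Q
  proof -
    \<comment> \<open>\<open>Q\<close> is padded with empty blocks to match the partition of
      \<open>E\<close>.\<close>
    have "Q = four_block_mat (0\<^sub>m 0 0) (0\<^sub>m 0 n) (0\<^sub>m n 0) Q"
      using Q by (intro eq_matI) auto
    then have "E * Q = four_block_mat (0\<^sub>m ?a 0) (0\<^sub>m ?a n) (0\<^sub>m n 0) (1\<^sub>m n) *
        four_block_mat (0\<^sub>m 0 0) (0\<^sub>m 0 n) (0\<^sub>m n 0) Q"
      unfolding E_block by simp
    also have "\<dots> = four_block_mat (0\<^sub>m ?a 0) (0\<^sub>m ?a n) (0\<^sub>m n 0) Q"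
      using Q by (subst mult_four_block_mat) auto
    finally show ?thesis unfolding E_block using Q by (subst mult_four_block_mat) auto
  qed
  show "E \<in> carrier_mat (n * m) n"
    using E by (simp add: mn mult.commute)
  show "N * E = E * P" unfolding N by (rule block[OF P])
  show "transpose_mat N * E = E * transpose_mat P" unfolding NT by (rule block) (use P in simp)
  show "transpose_mat E * E = 1\<^sub>m n"
    unfolding E_block
    by (subst transpose_four_block_mat[of _ ?a 0 _ n _ n], simp_all, subst mult_four_block_mat, auto)
qed

lemma transpose_kronecker:
  "transpose_mat (A \<otimes>\<^sub>K B) = transpose_mat A \<otimes>\<^sub>K transpose_mat B"
proof (rule eq_matI)
  fix i j assume "i < dim_row (transpose_mat A \<otimes>\<^sub>K transpose_mat B)"
    "j < dim_col (transpose_mat A \<otimes>\<^sub>K transpose_mat B)"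
  then have "i < dim_col A * dim_col B" "j < dim_row A * dim_row B"
    by (auto simp: kronecker_def)
  moreover from this have "i div dim_col B < dim_col A" "i mod dim_col B < dim_col B"
    "j div dim_row B < dim_row A" "j mod dim_row B < dim_row B"
    by (auto simp: less_mult_imp_div_less intro!: mod_less_divisor gr0I)
  ultimately show "transpose_mat (A \<otimes>\<^sub>K B) $$ (i, j) = (transpose_mat A \<otimes>\<^sub>K transpose_mat B) $$ (i, j)"
    by (simp add: kronecker_def)
qed (auto simp: kronecker_def)

text \<open>Row \<open>i\<close> of the left factor is a multiple of the unit vector at
  \<open>i mod n\<close>, so the product picks the matching row of \<open>B\<close>. This gives the
  off-diagonal blocks of the linearization the form \<open>F B\<close>.\<close>

lemma kronecker_column_factor:
  fixes B v :: "'a :: comm_ring_1 mat"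
  assumes B: "B \<in> carrier_mat n r" and v: "v \<in> carrier_mat m 1"
  shows "v \<otimes>\<^sub>K B = (v \<otimes>\<^sub>K 1\<^sub>m n) * B"
proof (rule eq_matI)
  fix i j assume "i < dim_row ((v \<otimes>\<^sub>K 1\<^sub>m n) * B)" "j < dim_col ((v \<otimes>\<^sub>K 1\<^sub>m n) * B)"
  then have i: "i < m * n" and j: "j < r" using v B by (auto simp: kronecker_def)
  from i have n: "n > 0" by (auto intro: gr0I)
  have "row (v \<otimes>\<^sub>K 1\<^sub>m n) i = v $$ (i div n, 0) \<cdot>\<^sub>v unit_vec n (i mod n)"
    using i v n by (intro eq_vecI) (auto simp: kronecker_def)
  then show "(v \<otimes>\<^sub>K B) $$ (i, j) = ((v \<otimes>\<^sub>K 1\<^sub>m n) * B) $$ (i, j)"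
    using i j v B n by (simp add: kronecker_def)
qed (use v B in \<open>auto simp: kronecker_def\<close>)

lemma kronecker_row_factor:
  fixes C v :: "'a :: comm_ring_1 mat"
  assumes C: "C \<in> carrier_mat r n" and v: "v \<in> carrier_mat m 1"
  shows "transpose_mat v \<otimes>\<^sub>K C = C * transpose_mat (v \<otimes>\<^sub>K 1\<^sub>m n)"
proof -
  have "transpose_mat v \<otimes>\<^sub>K C = transpose_mat (v \<otimes>\<^sub>K transpose_mat C)"
    by (simp add: transpose_kronecker)
  also have "v \<otimes>\<^sub>K transpose_mat C = (v \<otimes>\<^sub>K 1\<^sub>m n) * transpose_mat C"
    using C v by (intro kronecker_column_factor) auto
  also have "transpose_mat \<dots> = C * transpose_mat (v \<otimes>\<^sub>K 1\<^sub>m n)"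
    using C v by (subst transpose_mult[of _ "m * n" n _ r]) (auto simp: kronecker_def)
  finally show ?thesis .
qed

text \<open>All entries are 0 or 1, which a ring homomorphism fixes. The bounds on \<open>m\<close>
  and \<open>j\<close> keep the column index \<open>j - 1\<close> in range, also for
  \<open>j = 0\<close>, where the subtraction truncates.\<close>

lemma (in comm_ring_hom) mat_hom_e_col_kronecker_one:
  assumes "m \<ge> 1" "j \<le> m"
  shows "map_mat hom (e_col m j \<otimes>\<^sub>K 1\<^sub>m n) = e_col m j \<otimes>\<^sub>K 1\<^sub>m n"
  using assms by (intro eq_matI)
    (auto simp: kronecker_def e_col_def mat_of_cols_def less_mult_imp_div_less hom_mult)

section \<open>Identities from the reduction of the pencil\<close>

text \<open>Inserting \<open>U' U = 1\<close> gives \<open>L V E = U' N E = U' E P = F P\<close>;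
  cancelling \<open>V' V\<close> gives \<open>K^T V E = E^T E = 1\<close>. The statement is free of
  Fiedler data, so that it also covers the transposed pencil.\<close>

lemma reduced_pencil_intertwiner:
  fixes U L V U' V' N P E F K :: "'a :: comm_ring_1 mat"
  assumes U: "U \<in> carrier_mat k k" and L: "L \<in> carrier_mat k k" and V: "V \<in> carrier_mat k k"
    and U': "U' \<in> carrier_mat k k" and V': "V' \<in> carrier_mat k k"
    and E: "E \<in> carrier_mat k n" and P: "P \<in> carrier_mat n n"
    and U'U: "U' * U = 1\<^sub>m k" and V'V: "V' * V = 1\<^sub>m k"
    and N: "U * L * V = N" and NE: "N * E = E * P" and EE: "transpose_mat E * E = 1\<^sub>m n"
    and F: "U' * E = F" and K: "transpose_mat E * V' = transpose_mat K"
  shows "L * (V * E) = F * P" "transpose_mat K * (V * E) = 1\<^sub>m n"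
proof -
  have ET: "transpose_mat E \<in> carrier_mat n k" using E by simp
  have "L * (V * E) = U' * U * (L * (V * E))" using L V E by (simp add: U'U)
  also have "\<dots> = U' * (U * (L * (V * E)))" using U' U L V E by (intro assoc_mult_mat) auto
  also have "U * (L * (V * E)) = U * L * V * E"
    using assoc_mult_mat[OF L V E] assoc_mult_mat[OF U mult_carrier_mat[OF L V] E]
      assoc_mult_mat[OF U L V] by simp
  also have "U' * \<dots> = F * P"
    unfolding N NE F[symmetric] using U' E P by (intro assoc_mult_mat[symmetric]) auto
  finally show "L * (V * E) = F * P" .
  have "transpose_mat K * (V * E) = transpose_mat E * (V' * V * E)"
    unfolding K[symmetric] assoc_mult_mat[OF V' V E]
    using ET V' mult_carrier_mat[OF V E] by (rule assoc_mult_mat)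
  then show "transpose_mat K * (V * E) = 1\<^sub>m n" using E by (simp add: V'V EE)
qed

section \<open>Evaluation of the transfer function\<close>

text \<open>Map \<open>adj P * P = det P * 1\<close> through the homomorphism and multiply by
  \<open>X\<close> from the right.\<close>

lemma (in comm_ring_hom) mat_hom_adj_mat:
  assumes P: "P \<in> carrier_mat n n" and X: "X \<in> carrier_mat n n" and PX: "map_mat hom P * X = 1\<^sub>m n"
  shows "map_mat hom (adj_mat P) = hom (det P) \<cdot>\<^sub>m X"
proof -
  note adj = adj_mat[OF P]
  let ?H = "map_mat hom (adj_mat P)"
  have HP: "?H * map_mat hom P = hom (det P) \<cdot>\<^sub>m 1\<^sub>m n"
    unfolding mat_hom_mult[OF adj(1) P, symmetric] adj(3) by (intro eq_matI) auto
  have "?H = ?H * (map_mat hom P * X)" using adj(1) by (simp add: PX)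
  also have "\<dots> = ?H * map_mat hom P * X"
    using adj(1) P X by (intro assoc_mult_mat[symmetric]) auto
  also have "\<dots> = hom (det P) \<cdot>\<^sub>m X"
    unfolding HP using X by (simp add: mult_smult_assoc_mat[of _ n n])
  finally show ?thesis .
qed

text \<open>Clearing the denominator \<open>det P\<close> leaves a polynomial matrix. Its images
  under the embedding into rational functions and under evaluation at a point allow the two versions
  of the transfer function to be compared.\<close>

lemma (in comm_ring_hom) mat_hom_cleared_transfer_function:
  assumes P: "P \<in> carrier_mat n n" and X: "X \<in> carrier_mat n n" and PX: "map_mat hom P * X = 1\<^sub>m n"
    and B: "B \<in> carrier_mat n r" and C: "C \<in> carrier_mat r n" and D: "D \<in> carrier_mat r r"
  shows "map_mat hom (C * adj_mat P * B + det P \<cdot>\<^sub>m D)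
    = hom (det P) \<cdot>\<^sub>m (map_mat hom C * X * map_mat hom B + map_mat hom D)"
proof -
  note adj = adj_mat[OF P]
  have hB: "map_mat hom B \<in> carrier_mat n r" and hC: "map_mat hom C \<in> carrier_mat r n"
    and hD: "map_mat hom D \<in> carrier_mat r r" using B C D by auto
  have "map_mat hom (C * adj_mat P * B + det P \<cdot>\<^sub>m D)
      = map_mat hom (C * adj_mat P * B) + map_mat hom (det P \<cdot>\<^sub>m D)"
    using B C D by (intro eq_matI) (auto simp: hom_add)
  also have "map_mat hom (det P \<cdot>\<^sub>m D) = hom (det P) \<cdot>\<^sub>m map_mat hom D"
    by (intro eq_matI) (auto simp: hom_mult)
  also have "map_mat hom (C * adj_mat P * B) = map_mat hom C * map_mat hom (adj_mat P) * map_mat hom B"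
    by (simp only: mat_hom_mult[OF mult_carrier_mat[OF C adj(1)] B] mat_hom_mult[OF C adj(1)])
  also have "\<dots> = hom (det P) \<cdot>\<^sub>m (map_mat hom C * X * map_mat hom B)"
    unfolding mat_hom_adj_mat[OF P X PX]
    using hB hC X by (simp add: mult_smult_distrib[of _ r n] mult_smult_assoc_mat[of _ r n])
  finally show ?thesis
    using hB hC hD X by (simp add: add_smult_distrib_left_mat[of _ r r])
qed

text \<open>A value computed from any representation with nonvanishing denominator agrees with the
  one from the reduced fraction \<open>p / d\<close>: since \<open>b p = a d\<close>, a zero of
  \<open>d\<close> at \<open>z\<close> would be a zero of \<open>p\<close> too, and the common
  linear factor contradicts coprimality.\<close>

lemma eval_fract_eqI:
  assumes q: "to_fract b * q = to_fract a" and b: "poly b z \<noteq> 0"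
  shows "poly b z * eval_fract q z = poly a z"
proof -
  define p where "p = fst (quot_of_fract q)"
  define d where "d = snd (quot_of_fract q)"
  have d0: "d \<noteq> 0" and pq: "q = Fract p d" and cop: "coprime p d"
    by (simp_all add: p_def d_def coprime_quot_of_fract)
  have eq: "b * p = a * d"
    using q d0 by (simp add: pq to_fract_def eq_fract)
  then have eq_z: "poly b z * poly p z = poly a z * poly d z"
    by (metis poly_mult)
  have "poly d z \<noteq> 0"
  proof
    assume d_z: "poly d z = 0"
    with eq_z b have "poly p z = 0" by simp
    with d_z have "[:-z, 1:] dvd p" "[:-z, 1:] dvd d" by (simp_all add: poly_eq_0_iff_dvd)
    with cop have "is_unit [:-z, 1:]" by (rule coprime_common_divisor)
    then show False by (simp add: is_unit_iff_degree)
  qed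
  with eq_z show ?thesis by (simp add: eval_fract_def p_def[symmetric] d_def[symmetric] field_simps)
qed

text \<open>Both sides, multiplied by \<open>det P\<close>, come from the same polynomial matrix
  \<open>?Q\<close>, once through \<open>to_fract\<close> and once through evaluation at
  \<open>z\<close>.\<close>

lemma eval_transfer_function:
  assumes P: "P \<in> carrier_mat n n" and B: "B \<in> carrier_mat n r" and C: "C \<in> carrier_mat r n"
    and D: "D \<in> carrier_mat r r" and det_z: "poly (det P) z \<noteq> 0"
  shows "eval_rational_mat (transfer_function P B C D) z = C * mat_inv (eval_poly_mat P z) * B + D"
proof -
  interpret ev: comm_ring_hom "\<lambda>p :: complex poly. poly p z" by standard auto
  interpret fr: inj_comm_ring_hom "to_fract :: complex poly \<Rightarrow> complex poly fract"
    by (unfold_locales, auto)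
  let ?G = "transfer_function P B C D"
  let ?B = "const_poly_mat B" and ?C = "const_poly_mat C" and ?D = "const_poly_mat D"
  let ?Q = "?C * adj_mat P * ?B + det P \<cdot>\<^sub>m ?D"
  let ?F = "map_mat to_fract P"
  let ?R = "C * mat_inv (eval_poly_mat P z) * B + D"
  have BCD: "?B \<in> carrier_mat n r" "?C \<in> carrier_mat r n" "?D \<in> carrier_mat r r"
    using B C D by auto
  \<comment> \<open>A determinant with a nonzero value is a nonzero polynomial, hence a unit in the
    fraction field.\<close>
  have det0: "det P \<noteq> 0" using det_z by auto
  have F: "?F \<in> carrier_mat n n" using P by simp
  have "det ?F dvd 1" using det0 by (simp add: fr.hom_det dvd_field_iff)
  note F_inv = mat_inv_unit_det[OF F this]
  have G: "map_mat to_fract ?Q = to_fract (det P) \<cdot>\<^sub>m ?G"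
    unfolding transfer_function_def
    by (rule fr.mat_hom_cleared_transfer_function[OF P F_inv(1,2) BCD])
  have Pz: "eval_poly_mat P z \<in> carrier_mat n n" using P by (simp add: eval_poly_mat_def)
  have "det (eval_poly_mat P z) dvd 1" using det_z by (simp add: eval_poly_mat_def dvd_field_iff)
  note Pz_inv = mat_inv_unit_det[OF Pz this]
  have const: "map_mat (\<lambda>p. poly p z) (const_poly_mat X) = X" for X
    by (intro eq_matI) auto
  have R: "map_mat (\<lambda>p. poly p z) ?Q = poly (det P) z \<cdot>\<^sub>m ?R"
    using ev.mat_hom_cleared_transfer_function[OF P Pz_inv(1) _ BCD] Pz_inv(2)
    by (simp add: eval_poly_mat_def const)
  have dims: "dim_row ?G = r" "dim_col ?G = r" "dim_row ?R = r" "dim_col ?R = r"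
    "dim_row ?Q = r" "dim_col ?Q = r"
    using B C D by (simp_all add: transfer_function_def)
  show ?thesis
  proof (rule eq_matI)
    fix i j assume "i < dim_row ?R" "j < dim_col ?R"
    then have ij: "i < r" "j < r" by (simp_all only: dims)
    \<comment> \<open>Each entry of \<open>?G\<close> is a fraction with numerator from
      \<open>?Q\<close> and denominator \<open>det P\<close>, which does not vanish at
      \<open>z\<close>.\<close>
    have "to_fract (det P) * ?G $$ (i, j) = to_fract (?Q $$ (i, j))"
      using arg_cong[OF G, of "\<lambda>M. M $$ (i, j)"] ij dims by (simp only: index_map_mat index_smult_mat)
    then have "poly (det P) z * eval_fract (?G $$ (i, j)) z = poly (?Q $$ (i, j)) z"
      using det_z by (rule eval_fract_eqI)
    also have "\<dots> = poly (det P) z * ?R $$ (i, j)"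
      using arg_cong[OF R, of "\<lambda>M. M $$ (i, j)"] ij dims by (simp only: index_map_mat index_smult_mat)
    finally show "eval_rational_mat ?G z $$ (i, j) = ?R $$ (i, j)"
      using det_z ij dims by (simp add: eval_rational_mat_def)
  qed (use D dims(1,2) in \<open>simp_all add: eval_rational_mat_def\<close>)
qed

section \<open>Sizes of the Fiedler matrices and the pencil\<close>

lemma fiedler_mat_carrier:
  assumes A: "\<And>j. j \<le> m \<Longrightarrow> A j \<in> carrier_mat n n" and i: "i \<le> m" and m: "m \<ge> 1"
  shows "fiedler_mat n m A i \<in> carrier_mat (n * m) (n * m)"
proof -
  have dims: "dim_row (A j) = n" "dim_col (A j) = n" if "j \<le> m" for j
    using A[OF that] by auto
  \<comment> \<open>For inner \<open>i\<close> the two identity blocks have \<open>l\<close> and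
    \<open>k\<close> block rows; writing \<open>i\<close> and \<open>m\<close> through
    \<open>k\<close> and \<open>l\<close> removes the truncated subtractions.\<close>
  consider "i = 0" | "i = m" "i \<noteq> 0" | k l where "i = Suc k" "m = Suc (Suc (k + l))"
  proof (cases "i = 0 \<or> i = m")
    case False
    then obtain k where "i = Suc k" by (cases i) auto
    moreover from this False i obtain l where "m = Suc (i + l)"
      by (metis le_neq_implies_less less_iff_Suc_add)
    ultimately show ?thesis using that(3)[of k l] by simp
  qed (use that in auto)
  then show ?thesis
  proof cases
    case 1
    then show ?thesis using m by (cases m) (auto simp: fiedler_mat_def dims algebra_simps)
  next
    case 2
    then show ?thesis using m by (cases m) (auto simp: fiedler_mat_def dims algebra_simps)
  next
    case 3
    then show ?thesis by (auto simp: fiedler_mat_def dims algebra_simps)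
  qed
qed

lemma fiedler_pencil_carrier:
  assumes A: "\<And>j. j \<le> m \<Longrightarrow> A j \<in> carrier_mat n n" and m: "m \<ge> 1"
    and \<sigma>: "bij_betw \<sigma> {0..m - 1} {1..m}"
  shows "fiedler_pencil n m A \<sigma> \<in> carrier_mat (n * m) (n * m)"
proof -
  note carrier = fiedler_mat_carrier[of m A n, OF A _ m]
  have "inv_into {0..m - 1} \<sigma> k \<le> m" if "k \<in> {1..m}" for k
  proof -
    have "k \<in> \<sigma> ` {0..m - 1}" using that \<sigma> by (simp add: bij_betw_def)
    from inv_into_into[OF this] show ?thesis by auto
  qed
  then have prod: "foldr (*) (map (\<lambda>k. fiedler_mat n m A (inv_into {0..m - 1} \<sigma> k)) ks) (1\<^sub>m (n * m))
      \<in> carrier_mat (n * m) (n * m)" if "set ks \<subseteq> {1..m}" for ks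
    using that by (induction ks) (auto intro!: mult_carrier_mat carrier)
  have "fiedler_prod n m A \<sigma> \<in> carrier_mat (n * m) (n * m)"
    unfolding fiedler_prod_def by (rule prod) auto
  then show ?thesis
    using carrier[of m] by (auto simp: fiedler_pencil_def)
qed

section \<open>Isomorphisms of the right and left kernels\<close>

theorem theorem3p18:
  fixes n m r :: nat
    and A :: "nat \<Rightarrow> complex mat" and B C D :: "complex mat"
    and \<sigma> :: "nat \<Rightarrow> nat" and U V P S\<^sub>\<sigma> :: "complex poly mat"
    and G :: "complex poly fract mat" and z :: complex
  assumes "m \<ge> 1"
    and "\<And>j. j \<le> m \<Longrightarrow> A j \<in> carrier_mat n n"
    and "B \<in> carrier_mat n r" and "C \<in> carrier_mat r n" and "D \<in> carrier_mat r r"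
    and "P = matrix_polynomial n m A" and "regular_mat P"
    and "G = transfer_function P B C D" and "regular_mat G"
    and "bij_betw \<sigma> {0..m - 1} {1..m}"
    and "S\<^sub>\<sigma> = fiedler_linearization n m A B C D \<sigma>"
    and "fiedler_reduction n m A \<sigma> U V"
    and "rational_eigenvalue G z" and "invertible_mat (eval_poly_mat P z)"
  shows
        "vec_space_iso r (mat_kernel (eval_rational_mat G z))
           (n * m + r) (mat_kernel (eval_poly_mat S\<^sub>\<sigma> z))
           (E_map n m V P B z) \<and>
         vec_space_iso r (left_kernel (eval_rational_mat G z))
           (n * m + r) (left_kernel (eval_poly_mat S\<^sub>\<sigma> z))
           (H_map n m U P C z)"
proof -
  note m = assms(1) and A = assms(2) and B = assms(3) and C = assms(4) and D = assms(5)
  \<comment> \<open>The positions of the block row of \<open>C\<close> and the block column of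
    \<open>B\<close>. Since \<open>c = m\<close> when the first run of consecutions is empty, one
    formula with \<open>c\<close> and \<open>j\<close> covers both branches of
    \<open>fiedler_linearization\<close>.\<close>
  define c j where "c = m - ciss_c1 m \<sigma>"
    and "j = (if ciss_c1 m \<sigma> > 0 then m else m - ciss_i1 m \<sigma>)"
  define L where "L = fiedler_pencil n m A \<sigma>"
  define N where "N = diag_block_mat [1\<^sub>m ((m - 1) * n), P]"
  define E :: "complex poly mat" where "E = e_col m m \<otimes>\<^sub>K 1\<^sub>m n"
  define F :: "complex poly mat" where "F = e_col m j \<otimes>\<^sub>K 1\<^sub>m n"
  define K :: "complex poly mat" where "K = e_col m c \<otimes>\<^sub>K 1\<^sub>m n"
  let ?k = "n * m" and ?e = "\<lambda>M. eval_poly_mat M z"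
  interpret ev: comm_ring_hom "\<lambda>p :: complex poly. poly p z" by standard auto
  have e_mult: "?e (X * Y) = ?e X * ?e Y"
    if "X \<in> carrier_mat p q" "Y \<in> carrier_mat q t" for X Y p q t
    unfolding eval_poly_mat_def using that by (rule ev.mat_hom_mult)
  have e_one: "?e (1\<^sub>m p) = 1\<^sub>m p" for p
    unfolding eval_poly_mat_def by (rule ev.mat_hom_one)
  have e_carrier: "?e X \<in> carrier_mat p q" if "X \<in> carrier_mat p q" for X p q
    using that by (simp add: eval_poly_mat_def)
  have e_transpose: "?e (transpose_mat X) = transpose_mat (?e X)" for X
    by (simp add: eval_poly_mat_def map_mat_transpose)
  have e_det: "det (?e X) = poly (det X) z" for X
    by (simp add: eval_poly_mat_def)
  have e_const: "?e (const_poly_mat X) = X" for X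
    by (intro eq_matI) (auto simp: eval_poly_mat_def)

  have P: "P \<in> carrier_mat n n" by (simp add: assms(6) matrix_polynomial_def)
  have L: "L \<in> carrier_mat ?k ?k" unfolding L_def using A m assms(10) by (rule fiedler_pencil_carrier)
  note block = last_identity_block[OF P m, folded N_def E_def]
  note E = block(4)
  have ET: "transpose_mat E \<in> carrier_mat n ?k" using E by simp
  have F: "F \<in> carrier_mat ?k n" and K: "K \<in> carrier_mat ?k n"
    by (auto simp: F_def K_def kronecker_def e_col_def)
  have U: "U \<in> carrier_mat ?k ?k" and V: "V \<in> carrier_mat ?k ?k"
    and uni: "unimodular U" "unimodular V"
    and ULV: "U * L * V = N"
    and K_eq: "transpose_mat E * mat_inv V = transpose_mat K"
    and F_eq: "mat_inv U * E = F"
    using assms(12)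
    by (auto simp: fiedler_reduction_def L_def N_def E_def F_def K_def c_def j_def
        transpose_kronecker assms(6))
  \<comment> \<open>A nonzero constant is a unit of the polynomial ring, so \<open>mat_inv U\<close>
    and \<open>mat_inv V\<close> are genuine inverses with polynomial entries.\<close>
  have unit: "det X dvd 1" if "unimodular X" for X
    using that by (auto simp: unimodular_def is_unit_const_poly_iff dvd_field_iff)
  note U_inv = mat_inv_unit_det[OF U unit[OF uni(1)]]
  note V_inv = mat_inv_unit_det[OF V unit[OF uni(2)]]

  note EW = reduced_pencil_intertwiner[OF U L V U_inv(1) V_inv(1) E P U_inv(3) V_inv(3)
      ULV block(1,3) F_eq K_eq]
  \<comment> \<open>Transposition exchanges the sides: \<open>V^T\<close> and \<open>U^T\<close>
    reduce \<open>L^T\<close> to \<open>N^T\<close>, with \<open>K\<close> and \<open>F\<close>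
    swapped. The left inverses needed now are the transposed right inverses.\<close>
  have ULV_T: "transpose_mat V * transpose_mat L * transpose_mat U = transpose_mat N"
    using U L V by (simp flip: ULV add: transpose_mult[of _ ?k ?k _ ?k] assoc_mult_mat[of _ ?k ?k _ ?k _ ?k])
  have inv_T: "transpose_mat (mat_inv X) * transpose_mat X = 1\<^sub>m ?k"
    if "X \<in> carrier_mat ?k ?k" "mat_inv X \<in> carrier_mat ?k ?k" "X * mat_inv X = 1\<^sub>m ?k" for X :: "complex poly mat"
    using transpose_mult[OF that(1,2)] that(3) by simp
  have K_eq_T: "transpose_mat (mat_inv V) * E = K"
    using arg_cong[OF K_eq, of transpose_mat] transpose_mult[OF ET V_inv(1)] by simp
  have F_eq_T: "transpose_mat E * transpose_mat (mat_inv U) = transpose_mat F"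
    using arg_cong[OF F_eq, of transpose_mat] transpose_mult[OF U_inv(1) E] by simp
  note HW = reduced_pencil_intertwiner[of "transpose_mat V" ?k "transpose_mat L" "transpose_mat U"
      "transpose_mat (mat_inv V)" "transpose_mat (mat_inv U)" E n "transpose_mat P",
      OF _ _ _ _ _ E _ inv_T[OF V V_inv(1,2)] inv_T[OF U U_inv(1,2)] ULV_T block(2,3) K_eq_T F_eq_T]

  have Pz: "?e P \<in> carrier_mat n n" using P by (rule e_carrier)
  obtain Q where "inverts_mat (?e P) Q" "inverts_mat Q (?e P)"
    using assms(14) by (auto simp: invertible_mat_def)
  then have Q: "?e P * Q = 1\<^sub>m n" "Q * ?e P = 1\<^sub>m (dim_row Q)"
    using Pz by (auto simp: inverts_mat_def)
  \<comment> \<open>\<open>invertible_mat\<close> does not state the size of \<open>Q\<close>;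
    comparing the column counts in both products determines it.\<close>
  have Q_carrier: "Q \<in> carrier_mat n n"
    using arg_cong[OF Q(1), of dim_col] arg_cong[OF Q(2), of dim_col] Pz by auto
  from arg_cong[OF Q(1), of det] have "det (?e P) * det Q = 1"
    using det_mult[OF Pz Q_carrier] by simp
  then have detPz: "poly (det P) z \<noteq> 0" by (auto simp flip: e_det)
  then have "det (?e P) dvd 1" by (simp add: e_det dvd_field_iff)
  note Pz_inv = mat_inv_unit_det[OF Pz this]
  \<comment> \<open>Determinants of \<open>U L V = N\<close> show that \<open>det L\<close> divides
    \<open>det P\<close>, so \<open>det L\<close> cannot vanish at \<open>z\<close>.\<close>
  have "det N = det P"
    unfolding N_def diag_block_mat.simps(2)[of _ "[P]"] diag_block_mat_singleton Let_def
    using P by (simp add: det_four_block_mat_upper_right_zero[of _ "(m - 1) * n" _ n])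
  then have det_ULV: "det U * det L * det V = det P"
    using U L V by (simp flip: ULV add: det_mult[of _ ?k] mult.assoc)
  then have detL: "det (?e L) \<noteq> 0"
    using detPz by (auto simp: e_det simp flip: det_ULV)

  have G: "eval_rational_mat G z = C * mat_inv (?e P) * B + D"
    unfolding assms(8) using P B C D detPz by (rule eval_transfer_function)
  have jc: "j \<le> m" "c \<le> m" by (simp_all add: j_def c_def)
  have e_col: "e_col m i \<in> carrier_mat m 1" for i by (auto simp: e_col_def)
  have Fz: "?e F = e_col m j \<otimes>\<^sub>K 1\<^sub>m n" and Kz: "?e K = e_col m c \<otimes>\<^sub>K 1\<^sub>m n"
    unfolding F_def K_def eval_poly_mat_def
    using m jc by (simp_all add: ev.mat_hom_e_col_kronecker_one)
  have "S\<^sub>\<sigma> = four_block_mat (- L) (const_poly_mat (e_col m j \<otimes>\<^sub>K B))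
      (const_poly_mat (transpose_mat (e_col m c) \<otimes>\<^sub>K C)) (const_poly_mat D)"
    by (simp add: assms(11) fiedler_linearization_def L_def j_def c_def)
  also have "?e \<dots> = four_block_mat (?e (- L)) (e_col m j \<otimes>\<^sub>K B)
      (transpose_mat (e_col m c) \<otimes>\<^sub>K C) D"
    unfolding eval_poly_mat_def
    by (subst map_four_block_mat[of _ ?k ?k _ r _ r],
        use L B C D in \<open>auto simp: kronecker_def e_col_def e_const[unfolded eval_poly_mat_def]\<close>)
  also have "?e (- L) = - ?e L" by (intro eq_matI) (auto simp: eval_poly_mat_def)
  also have "e_col m j \<otimes>\<^sub>K B = ?e F * B"
    unfolding Fz by (rule kronecker_column_factor[OF B e_col])
  also have "transpose_mat (e_col m c) \<otimes>\<^sub>K C = C * transpose_mat (?e K)"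
    unfolding Kz by (rule kronecker_row_factor[OF C e_col])
  finally have S: "?e S\<^sub>\<sigma> = four_block_mat (- ?e L) (?e F * B) (C * transpose_mat (?e K)) D" .

  note carriers = e_carrier[OF L] e_carrier[OF F] e_carrier[OF K] Pz Pz_inv(1)
  have UT: "transpose_mat U \<in> carrier_mat ?k ?k" using U by simp
  have VE: "V * E \<in> carrier_mat ?k n" and UE: "transpose_mat U * E \<in> carrier_mat ?k n"
    using UT V E by simp_all
  have right: "vec_space_iso r (mat_kernel (eval_rational_mat G z)) (?k + r) (mat_kernel (?e S\<^sub>\<sigma>))
      (E_map n m V P B z)"
  proof -
    have "?e L * ?e (V * E) = ?e F * ?e P"
      using arg_cong[OF EW(1), of ?e] e_mult[OF L VE] e_mult[OF F P] by simp
    moreover have "transpose_mat (?e K) * ?e (V * E) = 1\<^sub>m n"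
      using arg_cong[OF EW(2), of ?e] e_mult[of "transpose_mat K" n ?k, OF _ VE] K
      by (simp add: e_transpose e_one)
    \<comment> \<open>The value of \<open>V * E\<close> serves as \<open>W\<close>, and the value of
      \<open>K\<close> takes the place of the matrix \<open>E\<close> in the lemma.\<close>
    ultimately show ?thesis
      unfolding G S E_map_def E_poly_def E_def[symmetric]
      using carriers VE B C D detL Pz_inv(2)
      by (intro system_matrix_kernel_iso[of _ _ "?e P"]) (auto intro: e_carrier)
  qed
  have left: "vec_space_iso r (left_kernel (eval_rational_mat G z)) (?k + r) (left_kernel (?e S\<^sub>\<sigma>))
      (H_map n m U P C z)"
  proof -
    let ?W = "?e (transpose_mat U * E)" and ?Q = "mat_inv (?e P)"
    \<comment> \<open>The transposed identities at \<open>z\<close>: now \<open>U^T E\<close> serves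
      as \<open>W\<close>, \<open>K\<close> takes the place of \<open>F\<close>, and
      \<open>F\<close> that of \<open>E\<close>.\<close>
    have LW: "transpose_mat (?e L) * ?W = ?e K * transpose_mat (?e P)"
      using arg_cong[OF HW(1), of ?e] e_mult[of "transpose_mat L" ?k ?k, OF _ UE]
        e_mult[of K ?k n "transpose_mat P" n] L K P U V U_inv(1) V_inv(1)
      by (simp add: e_transpose)
    have FW: "transpose_mat (?e F) * ?W = 1\<^sub>m n"
      using arg_cong[OF HW(2), of ?e] e_mult[of "transpose_mat F" n ?k, OF _ UE]
        F L P U V U_inv(1) V_inv(1)
      by (simp add: e_transpose e_one)
    have PQ: "transpose_mat (?e P) * transpose_mat ?Q = 1\<^sub>m n"
      using transpose_mult[OF Pz_inv(1) Pz] Pz_inv(3) by simp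
    have GT: "transpose_mat (eval_rational_mat G z)
        = transpose_mat B * transpose_mat ?Q * transpose_mat C + transpose_mat D"
    proof -
      have "transpose_mat (C * ?Q * B) = transpose_mat B * (transpose_mat ?Q * transpose_mat C)"
        using transpose_mult[OF mult_carrier_mat[OF C Pz_inv(1)] B] transpose_mult[OF C Pz_inv(1)]
        by simp
      also have "\<dots> = transpose_mat B * transpose_mat ?Q * transpose_mat C"
        using B C Pz_inv(1) by (intro assoc_mult_mat[symmetric]) auto
      finally show ?thesis unfolding G using B C D Pz_inv(1) by (simp add: transpose_add[of _ r r])
    qed
    \<comment> \<open>The transpose is again a system matrix of the same shape, with
      \<open>C^T\<close> as input block and \<open>B^T\<close> as output block.\<close>
    have ST: "transpose_mat (?e S\<^sub>\<sigma>) = four_block_mat (- transpose_mat (?e L))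
        (?e K * transpose_mat C) (transpose_mat B * transpose_mat (?e F)) (transpose_mat D)"
      unfolding S using carriers B C D
      by (subst transpose_four_block_mat[of _ ?k ?k _ r _ r])
        (auto simp: transpose_mult[of _ ?k n] transpose_mult[of _ r n] transpose_uminus)
    \<comment> \<open>\<open>H_map\<close> transposes \<open>C * ?Q\<close> as a whole; splitting
      and regrouping gives the product in the form \<open>W P' B\<close> of the lemma.\<close>
    have "transpose_mat (C * ?Q) = transpose_mat ?Q * transpose_mat C"
      using C Pz_inv(1) by (rule transpose_mult)
    moreover have "?W * (transpose_mat ?Q * transpose_mat C) = ?W * transpose_mat ?Q * transpose_mat C"
      using e_carrier[OF UE] C Pz_inv(1) by (intro assoc_mult_mat[symmetric]) auto
    ultimately show ?thesis
      unfolding left_kernel_eq_mat_kernel_transpose GT ST H_map_def H_poly_def E_def[symmetric]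
      using carriers e_carrier[OF UE] B C D detL LW FW PQ
      by (simp only:) (intro system_matrix_kernel_iso[of _ _ "transpose_mat (?e P)"],
        auto simp: det_transpose)
  qed
  show ?thesis using right left by blast
qed

end
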